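(* Let $X:\Sigma\to\mathbb{R}^3$ be a non-planar minimal surface with planar curvature lines in isothermic coordinates $(u,v)$, with metric $e^{2\omega}(du^2+dv^2)$ and unit normal $N$, and let $f(u)=e^{\omega}\omega_u$ and $g(v)=e^{\omega}\omega_v$. If $f(u)$ (resp. $g(v)$) is not identically equal to zero, then there is a unique constant direction $\vec v_1$ (resp. $\vec v_2$) such that $$\langle m(u,v),\vec v_1\rangle=\langle m_v(u,v),\vec v_1\rangle=0\qquad\text{(resp. }\langle n(u,v),\vec v_2\rangle=\langle n_u(u,v),\vec v_2\rangle=0\text{)},$$ where $m=e^{-2\omega}(X_u\times X_{uu})$ (resp. $n=e^{-2\omega}(X_v\times X_{vv})$), and $$\vec v_1=\omega_{uu}X_u-\omega_{uv}X_v+\omega_uN\qquad\text{(resp. }\vec v_2=\omega_{uv}X_u-\omega_{vv}X_v+\omega_vN\text{)}.$$ Furthermore, if $\vec v_1$ and $\vec v_2$ both exist, then $\vec v_1$ is orthogonal to $\vec v_2$.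
   Context: $\Sigma\subset\mathbb{R}^2$ is a simply-connected domain and $X:\Sigma\to\mathbb{R}^3$ a conformal immersion with $ds^2=e^{2\omega}(du^2+dv^2)$, $\omega:\Sigma\to\mathbb{R}$, and unit normal field $N$. Minimal means mean curvature zero. The surface is umbilic-free, and isothermic coordinates are conformal curvature line coordinates, normalized so that the Hopf differential factor $Q=\frac14\langle X_{uu}-2iX_{uv}-X_{vv},N\rangle$ equals $-\frac12$. The Gauss–Weingarten equations are then $$X_{uu}=\omega_uX_u-\omega_vX_v-N,\quad X_{vv}=-\omega_uX_u+\omega_vX_v+N,\quad X_{uv}=\omega_vX_u+\omega_uX_v,$$ $$N_u=e^{-2\omega}X_u,\quad N_v=-e^{-2\omega}X_v,$$ and $\omega$ satisfies $\Delta\omega-e^{-2\omega}=0$ together with the planar curvature line condition $\omega_{uv}+\omega_u\omega_v=0$. In particular $e^\omega\omega_u$ depends only on $u$ and $e^\omega\omega_v$ only on $v$. A direction means a nonzero vector up to nonzero scalar multiples; constant means independent of $(u,v)$. The vectors $\vec v_1,\vec v_2$ are called the axial directions of the surface. *)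

theory Defs
  imports "HOL-Analysis.Analysis"
begin

section \<open>Partial derivatives and smoothness on plane domains\<close>

definition Du :: "(real \<times> real \<Rightarrow> 'a::real_normed_vector) \<Rightarrow> real \<times> real \<Rightarrow> 'a" where
  "Du F = (\<lambda>(u, v). vector_derivative (\<lambda>s. F (s, v)) (at u))"

definition Dv :: "(real \<times> real \<Rightarrow> 'a::real_normed_vector) \<Rightarrow> real \<times> real \<Rightarrow> 'a" where
  "Dv F = (\<lambda>(u, v). vector_derivative (\<lambda>t. F (u, t)) (at v))"

primrec Ck_on :: "nat \<Rightarrow> (real \<times> real) set \<Rightarrow> (real \<times> real \<Rightarrow> 'a::real_normed_vector) \<Rightarrow> bool" where
  "Ck_on 0 S F \<longleftrightarrow> continuous_on S F"
| "Ck_on (Suc k) S F \<longleftrightarrow>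
     (\<forall>(u, v)\<in>S. (\<lambda>s. F (s, v)) differentiable (at u) \<and> (\<lambda>t. F (u, t)) differentiable (at v)) \<and>
     Ck_on k S (Du F) \<and> Ck_on k S (Dv F)"

definition smooth_on :: "(real \<times> real) set \<Rightarrow> (real \<times> real \<Rightarrow> 'a::real_normed_vector) \<Rightarrow> bool" where
  "smooth_on S F \<longleftrightarrow> (\<forall>k. Ck_on k S F)"

section \<open>Surfaces in Euclidean 3-space\<close>

definition conformal_immersion ::
    "(real \<times> real) set \<Rightarrow> (real \<times> real \<Rightarrow> real^3) \<Rightarrow> (real \<times> real \<Rightarrow> real) \<Rightarrow> bool" where
  "conformal_immersion S X \<omega> \<longleftrightarrow>
     smooth_on S X \<and> smooth_on S \<omega> \<and>
     (\<forall>p\<in>S. inj (frechet_derivative X (at p))) \<and>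
     (\<forall>p\<in>S. Du X p \<bullet> Du X p = exp (2 * \<omega> p) \<and>
            Dv X p \<bullet> Dv X p = exp (2 * \<omega> p) \<and>
            Du X p \<bullet> Dv X p = 0)"

text \<open>Either of the two orientations is allowed here; the normalization of the Hopf differential
  below selects one of them.\<close>

definition unit_normal_field ::
    "(real \<times> real) set \<Rightarrow> (real \<times> real \<Rightarrow> real^3) \<Rightarrow> (real \<times> real \<Rightarrow> real^3) \<Rightarrow> bool" where
  "unit_normal_field S X N \<longleftrightarrow>
     smooth_on S N \<and>
     (\<forall>p\<in>S. norm (N p) = 1 \<and> N p \<bullet> Du X p = 0 \<and> N p \<bullet> Dv X p = 0)"

definition mean_curvature ::
    "(real \<times> real \<Rightarrow> real^3) \<Rightarrow> (real \<times> real \<Rightarrow> real^3) \<Rightarrow> real \<times> real \<Rightarrow> real" where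
  "mean_curvature X N p =
     (let E = Du X p \<bullet> Du X p; F = Du X p \<bullet> Dv X p; G = Dv X p \<bullet> Dv X p;
          L = Du (Du X) p \<bullet> N p; M = Dv (Du X) p \<bullet> N p; K = Dv (Dv X) p \<bullet> N p
      in (L * G - 2 * M * F + K * E) / (2 * (E * G - F\<^sup>2)))"

definition minimal_surface ::
    "(real \<times> real) set \<Rightarrow> (real \<times> real \<Rightarrow> real^3) \<Rightarrow> (real \<times> real \<Rightarrow> real^3) \<Rightarrow> bool" where
  "minimal_surface S X N \<longleftrightarrow> (\<forall>p\<in>S. mean_curvature X N p = 0)"

text \<open>The inner product is extended complex bilinearly to \<open>X\<^sub>u\<^sub>u - 2 i X\<^sub>u\<^sub>v - X\<^sub>v\<^sub>v\<close>.\<close>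

definition hopf_factor ::
    "(real \<times> real \<Rightarrow> real^3) \<Rightarrow> (real \<times> real \<Rightarrow> real^3) \<Rightarrow> real \<times> real \<Rightarrow> complex" where
  "hopf_factor X N p =
     (1 / 4) * (complex_of_real (Du (Du X) p \<bullet> N p)
                - 2 * \<i> * complex_of_real (Dv (Du X) p \<bullet> N p)
                - complex_of_real (Dv (Dv X) p \<bullet> N p))"

definition umbilic ::
    "(real \<times> real \<Rightarrow> real^3) \<Rightarrow> (real \<times> real \<Rightarrow> real^3) \<Rightarrow> real \<times> real \<Rightarrow> bool" where
  "umbilic X N p \<longleftrightarrow> (\<exists>k. Du N p = - k *\<^sub>R Du X p \<and> Dv N p = - k *\<^sub>R Dv X p)"

text \<open>Both coordinate directions are principal (Rodrigues' equations).\<close>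

definition curvature_line_coordinates ::
    "(real \<times> real) set \<Rightarrow> (real \<times> real \<Rightarrow> real^3) \<Rightarrow> (real \<times> real \<Rightarrow> real^3) \<Rightarrow> bool" where
  "curvature_line_coordinates S X N \<longleftrightarrow>
     (\<forall>p\<in>S. \<exists>k1 k2. Du N p = - k1 *\<^sub>R Du X p \<and> Dv N p = - k2 *\<^sub>R Dv X p)"

text \<open>For curvature line coordinates the curvature lines are the coordinate curves. Only arcs whose
  parameter segment stays inside the domain are considered, since a horizontal or vertical slice of
  the domain may be disconnected and then consists of several curvature lines.\<close>

definition planar_curvature_lines ::
    "(real \<times> real) set \<Rightarrow> (real \<times> real \<Rightarrow> real^3) \<Rightarrow> bool" where
  "planar_curvature_lines S X \<longleftrightarrow>
     (\<forall>a b c. {a..b} \<times> {c} \<subseteq> S \<longrightarrow> coplanar (X ` ({a..b} \<times> {c}))) \<and>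
     (\<forall>a b c. {c} \<times> {a..b} \<subseteq> S \<longrightarrow> coplanar (X ` ({c} \<times> {a..b})))"

section \<open>Axial directions\<close>

definition m_field ::
    "(real \<times> real \<Rightarrow> real^3) \<Rightarrow> (real \<times> real \<Rightarrow> real) \<Rightarrow> real \<times> real \<Rightarrow> real^3" where
  "m_field X \<omega> = (\<lambda>p. exp (- 2 * \<omega> p) *\<^sub>R cross3 (Du X p) (Du (Du X) p))"

definition n_field ::
    "(real \<times> real \<Rightarrow> real^3) \<Rightarrow> (real \<times> real \<Rightarrow> real) \<Rightarrow> real \<times> real \<Rightarrow> real^3" where
  "n_field X \<omega> = (\<lambda>p. exp (- 2 * \<omega> p) *\<^sub>R cross3 (Dv X p) (Dv (Dv X) p))"

text \<open>A direction is a nonzero vector up to nonzero scalar multiples; \<open>w\<close> represents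
  the only direction satisfying \<open>P\<close>.\<close>

definition unique_direction :: "('a::real_vector \<Rightarrow> bool) \<Rightarrow> 'a \<Rightarrow> bool" where
  "unique_direction P w \<longleftrightarrow>
     w \<noteq> 0 \<and> P w \<and> (\<forall>w'. w' \<noteq> 0 \<and> P w' \<longrightarrow> (\<exists>c. c \<noteq> 0 \<and> w' = c *\<^sub>R w))"

definition axial_direction_1 ::
    "(real \<times> real) set \<Rightarrow> (real \<times> real \<Rightarrow> real^3) \<Rightarrow> (real \<times> real \<Rightarrow> real) \<Rightarrow> real^3 \<Rightarrow> bool" where
  "axial_direction_1 S X \<omega> =
     unique_direction (\<lambda>w. \<forall>p\<in>S. m_field X \<omega> p \<bullet> w = 0 \<and> Dv (m_field X \<omega>) p \<bullet> w = 0)"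

definition axial_direction_2 ::
    "(real \<times> real) set \<Rightarrow> (real \<times> real \<Rightarrow> real^3) \<Rightarrow> (real \<times> real \<Rightarrow> real) \<Rightarrow> real^3 \<Rightarrow> bool" where
  "axial_direction_2 S X \<omega> =
     unique_direction (\<lambda>w. \<forall>p\<in>S. n_field X \<omega> p \<bullet> w = 0 \<and> Du (n_field X \<omega>) p \<bullet> w = 0)"

end

theory Submission
  imports Defs
begin

text \<open>
  In the frame \<open>(X\<^sub>u, X\<^sub>v, N)\<close> everything is governed by the Gauss-Weingarten equations together
  with two scalar equations for \<open>\<omega>\<close>: the Gauss equation \<open>\<omega>\<^sub>u\<^sub>u + \<omega>\<^sub>v\<^sub>v = e\<^sup>-\<^sup>2\<^sup>\<omega>\<close>, which expresses that
  \<open>(X\<^sub>u\<^sub>u)\<^sub>v = (X\<^sub>u\<^sub>v)\<^sub>u\<close>, and \<open>\<omega>\<^sub>u\<^sub>v + \<omega>\<^sub>u \<omega>\<^sub>v = 0\<close>, which expresses that \<open>X\<^sub>u\<close>, \<open>X\<^sub>u\<^sub>u\<close>, \<open>X\<^sub>u\<^sub>u\<^sub>u\<close> lie in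
  the plane of the curvature line (\<open>gauss_weingarten_of_surface\<close>).

  Up to a nonzero factor at each point, which only records the orientation of the frame, \<open>m\<close> is
  \<open>b = e\<^sup>-\<^sup>2\<^sup>\<omega> X\<^sub>v - \<omega>\<^sub>v N\<close> (\<open>m_field_eq_binormal\<close>). Being orthogonal to \<open>m\<close> everywhere therefore means
  being orthogonal to \<open>b\<close> everywhere, and no derivative of \<open>m\<close> ever has to be computed: if \<open>w\<close> is
  constant and orthogonal to \<open>m\<close>, then it is automatically orthogonal to \<open>m\<^sub>v\<close>.

  \<^item> Existence: the vector field \<open>\<omega>\<^sub>u\<^sub>u X\<^sub>u - \<omega>\<^sub>u\<^sub>v X\<^sub>v + \<omega>\<^sub>u N\<close> is orthogonal to \<open>b\<close>, because of the second
    scalar equation. Both scalar equations and their first derivatives make its partial derivatives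
    vanish, so it is constant (\<open>axial_vector_u\<close>, \<open>axial_vector_v\<close>).
  \<^item> Uniqueness: a constant \<open>w\<close> orthogonal to \<open>b\<close> is orthogonal to \<open>b\<^sub>v = \<omega>\<^sub>u\<^sub>u N - \<omega>\<^sub>u e\<^sup>-\<^sup>2\<^sup>\<omega> X\<^sub>u\<close>. Where
    \<open>\<omega>\<^sub>u \<noteq> 0\<close> this is independent of \<open>b\<close>, which leaves one line for \<open>w\<close>
    (\<open>perp_binormal_imp_parallel_axial_vector\<close>).
  \<^item> Conversely, if \<open>\<omega>\<^sub>u\<close> vanishes identically then \<open>b\<close> is constant. All vectors of a plane are then
    orthogonal to \<open>m\<close> and \<open>m\<^sub>v\<close>, and no axial direction exists (\<open>axial_direction_1_imp_nonzero\<close>).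
    Hence an axial direction is always represented by the vector field above.

  Interchanging \<open>u\<close> with \<open>v\<close> and replacing \<open>N\<close> by \<open>-N\<close> preserves all equations
  (\<open>gauss_weingarten.swapped\<close>), turns \<open>n\<close> into \<open>m\<close>, and so gives the statement about the second family.
  Orthogonality is the computation
  \<open>\<langle>v\<^sub>1, v\<^sub>2\<rangle> = \<omega>\<^sub>u\<^sub>v e\<^sup>2\<^sup>\<omega> (\<omega>\<^sub>u\<^sub>u + \<omega>\<^sub>v\<^sub>v) + \<omega>\<^sub>u \<omega>\<^sub>v = \<omega>\<^sub>u\<^sub>v + \<omega>\<^sub>u \<omega>\<^sub>v = 0\<close>.
\<close>

section \<open>Partial derivatives along a direction\<close>

text \<open>Keeping the direction \<open>e\<close> as a parameter gives one set of differentiation rules for both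
  coordinate derivatives. The interchange of coordinates then only moves \<open>e\<close>.\<close>
definition has_partial ::
    "real \<times> real \<Rightarrow> (real \<times> real \<Rightarrow> 'a::real_normed_vector) \<Rightarrow> 'a \<Rightarrow> real \<times> real \<Rightarrow> bool" where
  "has_partial e F D p \<longleftrightarrow> ((\<lambda>t. F (p + t *\<^sub>R e)) has_vector_derivative D) (at 0)"

lemma has_partial_horizontal:
  "has_partial (1, 0) F D (u, v) \<longleftrightarrow> ((\<lambda>s. F (s, v)) has_vector_derivative D) (at u)"
proof -
  have shift: "((\<lambda>t. G (a + t)) has_vector_derivative D) (at b)"
    if "(G has_vector_derivative D) (at (a + b))" for G :: "real \<Rightarrow> 'a" and a b
  proof -
    have "((\<lambda>t. a + t) has_vector_derivative 1) (at b)"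
      by (auto intro!: derivative_eq_intros)
    from vector_diff_chain_at[OF this that] show ?thesis by (simp add: o_def)
  qed
  show ?thesis
    using shift[of "\<lambda>s. F (s, v)" u 0] shift[of "\<lambda>t. F (u + t, v)" "- u" u]
    by (auto simp: has_partial_def)
qed

lemma has_partial_unique:
  assumes "has_partial e F D p" "has_partial e F D' p"
  shows "D = D'"
  using assms unfolding has_partial_def by (rule vector_derivative_unique_at)

lemma has_partial_cong:
  assumes "open S" "p \<in> S" "\<And>q. q \<in> S \<Longrightarrow> F q = G q" "has_partial e F D p"
  shows "has_partial e G D p"
proof -
  have "open ((\<lambda>t::real. p + t *\<^sub>R e) -` S)"
    by (intro open_vimage assms continuous_intros)
  then show ?thesis
    using assms unfolding has_partial_def
    by (elim has_vector_derivative_transform_within_open) auto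
qed

lemma has_partial_const: "has_partial e (\<lambda>_. c) 0 p"
  unfolding has_partial_def by (rule has_vector_derivative_const)

lemma has_partial_add:
  "has_partial e F D p \<Longrightarrow> has_partial e G D' p \<Longrightarrow> has_partial e (\<lambda>q. F q + G q) (D + D') p"
  unfolding has_partial_def by (rule has_vector_derivative_add)

lemma has_partial_diff:
  "has_partial e F D p \<Longrightarrow> has_partial e G D' p \<Longrightarrow> has_partial e (\<lambda>q. F q - G q) (D - D') p"
  unfolding has_partial_def by (rule has_vector_derivative_diff)

lemma has_partial_minus:
  "has_partial e F D p \<Longrightarrow> has_partial e (\<lambda>q. - F q) (- D) p"
  unfolding has_partial_def by (rule has_vector_derivative_minus)

lemma has_partial_bilinear:
  assumes "bounded_bilinear B" "has_partial e F D p" "has_partial e G D' p"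
  shows "has_partial e (\<lambda>q. B (F q) (G q)) (B (F p) D' + B D (G p)) p"
  using bounded_bilinear.has_vector_derivative[OF assms(1)] assms(2,3)
  unfolding has_partial_def by fastforce

lemmas has_partial_scaleR = has_partial_bilinear[OF bounded_bilinear_scaleR]
lemmas has_partial_inner = has_partial_bilinear[OF bounded_bilinear_inner]
lemmas has_partial_mult = has_partial_bilinear[OF bounded_bilinear_mult]
lemmas has_partial_cross =
  has_partial_bilinear[OF bilinear_cross[unfolded bilinear_conv_bounded_bilinear]]

lemma has_partial_exp:
  fixes f :: "real \<times> real \<Rightarrow> real"
  assumes "has_partial e f d p"
  shows "has_partial e (\<lambda>q. exp (c * f q)) (c * d * exp (c * f p)) p"
proof -
  have "((\<lambda>t. f (p + t *\<^sub>R e)) has_real_derivative d) (at 0)"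
    using assms by (simp add: has_partial_def has_real_derivative_iff_has_vector_derivative)
  then have "((\<lambda>t. exp (c * f (p + t *\<^sub>R e))) has_real_derivative c * d * exp (c * f p)) (at 0)"
    by (auto intro!: derivative_eq_intros)
  then show ?thesis
    by (simp add: has_partial_def has_real_derivative_iff_has_vector_derivative)
qed

lemmas has_partial_intros = has_partial_const has_partial_add has_partial_diff has_partial_minus
  has_partial_inner has_partial_mult has_partial_scaleR has_partial_exp

lemma has_partial_swap:
  "has_partial (1, 0) (F \<circ> prod.swap) D p \<longleftrightarrow> has_partial (0, 1) F D (prod.swap p)"
  "has_partial (0, 1) (F \<circ> prod.swap) D p \<longleftrightarrow> has_partial (1, 0) F D (prod.swap p)"
  by (cases p; simp add: has_partial_def)+

lemma has_partial_vertical: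
  "has_partial (0, 1) F D (u, v) \<longleftrightarrow> ((\<lambda>t. F (u, t)) has_vector_derivative D) (at v)"
  using has_partial_horizontal[of "F \<circ> prod.swap" D v u] unfolding has_partial_swap by simp

lemma Du_eqI: "has_partial (1, 0) F D p \<Longrightarrow> Du F p = D"
  by (cases p) (simp add: has_partial_horizontal Du_def vector_derivative_at)

lemma Dv_eqI: "has_partial (0, 1) F D p \<Longrightarrow> Dv F p = D"
  by (cases p) (simp add: has_partial_vertical Dv_def vector_derivative_at)

section \<open>Smooth functions\<close>

lemma smooth_on_partials:
  assumes "smooth_on S F"
  shows "smooth_on S (Du F)" "smooth_on S (Dv F)"
    "p \<in> S \<Longrightarrow> has_partial (1, 0) F (Du F p) p"
    "p \<in> S \<Longrightarrow> has_partial (0, 1) F (Dv F p) p"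
proof -
  have C: "Ck_on (Suc k) S F" for k
    using assms by (simp only: smooth_on_def)
  then show "smooth_on S (Du F)" "smooth_on S (Dv F)"
    by (simp_all add: smooth_on_def)
  show "has_partial (1, 0) F (Du F p) p" "has_partial (0, 1) F (Dv F p) p" if "p \<in> S"
    using C[of 0] that
    by (cases p; auto simp: has_partial_horizontal has_partial_vertical Du_def Dv_def
        vector_derivative_works[symmetric])+
qed

lemma smooth_on_continuous: "smooth_on S F \<Longrightarrow> continuous_on S F"
  using Ck_on.simps(1) smooth_on_def by blast

lemma Du_swap: "Du (F \<circ> prod.swap) = Dv F \<circ> prod.swap"
  and Dv_swap: "Dv (F \<circ> prod.swap) = Du F \<circ> prod.swap"
  by (auto simp: Du_def Dv_def)

lemma Ck_on_swap: "Ck_on k S F \<Longrightarrow> Ck_on k (prod.swap -` S) (F \<circ> prod.swap)"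
proof (induction k arbitrary: F)
  case 0
  then show ?case
    by (auto intro!: continuous_on_compose2[of S F] continuous_on_swap simp: o_def)
next
  case (Suc k)
  then show ?case
    by (auto simp: Du_swap Dv_swap simp del: o_apply) (auto simp: o_def)
qed

lemma smooth_on_swap: "smooth_on S F \<Longrightarrow> smooth_on (prod.swap -` S) (F \<circ> prod.swap)"
  by (simp add: smooth_on_def Ck_on_swap)


section \<open>Symmetry of mixed partial derivatives\<close>

text \<open>Two applications of the mean value theorem write the second difference of \<open>f\<close> over a square as
  a value of \<open>f\<^sub>u\<^sub>v\<close>. For the function with interchanged arguments the second difference is the same,
  but the value is one of \<open>f\<^sub>v\<^sub>u\<close>; this gives the symmetry below.\<close>
lemma second_difference_mean_value:
  fixes f :: "real \<times> real \<Rightarrow> real"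
  assumes "h > 0"
    and u: "\<And>q. q \<in> {a..a+h} \<times> {b..b+h} \<Longrightarrow> has_partial (1, 0) f (fu q) q"
    and uv: "\<And>q. q \<in> {a..a+h} \<times> {b..b+h} \<Longrightarrow> has_partial (0, 1) fu (fuv q) q"
  obtains q where "q \<in> {a..a+h} \<times> {b..b+h}"
    "f (a+h, b+h) - f (a+h, b) - f (a, b+h) + f (a, b) = h * h * fuv q"
proof -
  have "\<exists>\<xi>. a < \<xi> \<and> \<xi> < a+h \<and>
      (f (a+h, b+h) - f (a+h, b)) - (f (a, b+h) - f (a, b)) =
        ((a+h) - a) * (fu (\<xi>, b+h) - fu (\<xi>, b))"
    using \<open>h > 0\<close> u
    by (intro MVT2)
       (auto intro!: has_vector_derivative_diff
          simp: has_partial_horizontal has_real_derivative_iff_has_vector_derivative)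
  then obtain \<xi> where \<xi>: "a < \<xi>" "\<xi> < a+h"
      "(f (a+h, b+h) - f (a+h, b)) - (f (a, b+h) - f (a, b)) =
        h * (fu (\<xi>, b+h) - fu (\<xi>, b))"
    by auto
  have "\<exists>\<eta>. b < \<eta> \<and> \<eta> < b+h \<and>
      fu (\<xi>, b+h) - fu (\<xi>, b) = ((b+h) - b) * fuv (\<xi>, \<eta>)"
    using \<open>h > 0\<close> uv \<xi>
    by (intro MVT2)
       (auto simp: has_partial_vertical has_real_derivative_iff_has_vector_derivative)
  then obtain \<eta> where "b < \<eta>" "\<eta> < b+h" "fu (\<xi>, b+h) - fu (\<xi>, b) = h * fuv (\<xi>, \<eta>)"
    by auto
  with \<xi> show ?thesis
    by (intro that[of "(\<xi>, \<eta>)"]) auto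
qed

text \<open>Schwarz's theorem for vector-valued functions. It is reduced to the real function \<open>F \<bullet> b\<close>, where
  \<open>b\<close> is the difference of the two mixed derivatives, so that \<open>b \<bullet> b\<close> is what has to vanish.\<close>
lemma mixed_partials_eq:
  fixes F :: "real \<times> real \<Rightarrow> 'a::real_inner"
  assumes S: "open S" "p \<in> S" and F: "smooth_on S F"
  shows "Du (Dv F) p = Dv (Du F) p"
proof -
  define b where "b = Du (Dv F) p - Dv (Du F) p"
  define f where "f q = F q \<bullet> b" for q
  define fuv where "fuv q = Dv (Du F) q \<bullet> b" for q
  define fvu where "fvu q = Du (Dv F) q \<bullet> b" for q
  have "continuous_on S fuv" "continuous_on S fvu"
    unfolding fuv_def fvu_def
    by (intro continuous_intros smooth_on_continuous smooth_on_partials F)+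
  then have cont: "isCont fuv p" "isCont fvu p"
    using S continuous_on_eq_continuous_at by blast+
  have inner: "has_partial e (\<lambda>q. G q \<bullet> b) (D \<bullet> b) q" if "has_partial e G D q"
    for e D q and G :: "real \<times> real \<Rightarrow> 'a"
    using has_partial_inner[OF that has_partial_const[of e b q]] by simp
  have partials: "has_partial (1, 0) f (Du F q \<bullet> b) q" "has_partial (0, 1) f (Dv F q \<bullet> b) q"
    "has_partial (0, 1) (\<lambda>q. Du F q \<bullet> b) (fuv q) q" "has_partial (1, 0) (\<lambda>q. Dv F q \<bullet> b) (fvu q) q"
    if "q \<in> S" for q
    unfolding f_def[abs_def] fuv_def fvu_def
    using inner smooth_on_partials(3,4)[OF F that]
      smooth_on_partials(4)[OF smooth_on_partials(1)[OF F] that]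
      smooth_on_partials(3)[OF smooth_on_partials(2)[OF F] that] by blast+
  have "b \<bullet> b \<le> 0 + \<epsilon>" if "\<epsilon> > 0" for \<epsilon>
  proof -
    have "\<forall>\<^sub>F q in nhds p. q \<in> S"
      using S by (simp add: eventually_nhds_in_open)
    moreover have "\<forall>\<^sub>F q in nhds p. dist (fuv q) (fuv p) < \<epsilon> / 2"
      "\<forall>\<^sub>F q in nhds p. dist (fvu q) (fvu p) < \<epsilon> / 2"
      using cont \<open>\<epsilon> > 0\<close> unfolding isCont_def tendsto_at_iff_tendsto_nhds
      by (auto dest: tendstoD[where e = "\<epsilon> / 2"])
    ultimately have "\<forall>\<^sub>F q in nhds p. q \<in> S \<and> dist (fuv q) (fuv p) < \<epsilon> / 2 \<and> dist (fvu q) (fvu p) < \<epsilon> / 2"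
      by eventually_elim auto
    then obtain d where "d > 0" and
      d: "\<And>q. dist q p < d \<Longrightarrow> q \<in> S \<and> dist (fuv q) (fuv p) < \<epsilon> / 2 \<and> dist (fvu q) (fvu p) < \<epsilon> / 2"
      by (auto simp: eventually_nhds_metric)
    \<comment> \<open>The side is small enough for the square to lie in the ball of radius \<open>d\<close>: \<open>2 h < d\<close>.\<close>
    define h where "h = d / 3"
    have "h > 0" using \<open>d > 0\<close> by (simp add: h_def)
    obtain x y where p: "p = (x, y)" by (cases p)
    have box: "dist q p < d" if "q \<in> {x..x+h} \<times> {y..y+h}" for q
    proof -
      have "dist q p \<le> dist (fst q) x + dist (snd q) y"
        using sqrt_sum_squares_le_sum_abs[of "dist (fst q) x" "dist (snd q) y"]
        by (cases q) (simp add: p dist_Pair_Pair)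
      also have "\<dots> \<le> h + h"
        using that by (auto simp: dist_real_def)
      finally show ?thesis using \<open>d > 0\<close> by (simp add: h_def)
    qed
    obtain q where q: "q \<in> {x..x+h} \<times> {y..y+h}"
      "f (x+h, y+h) - f (x+h, y) - f (x, y+h) + f (x, y) = h * h * fuv q"
      by (rule second_difference_mean_value[OF \<open>h > 0\<close>, where f=f and fu="\<lambda>q. Du F q \<bullet> b" and fuv=fuv])
        (use d box partials in blast)+
    obtain r where r: "r \<in> {y..y+h} \<times> {x..x+h}"
      "f (x+h, y+h) - f (x, y+h) - f (x+h, y) + f (x, y) = h * h * fvu (prod.swap r)"
      by (rule second_difference_mean_value[OF \<open>h > 0\<close>, of y x "f \<circ> prod.swap"
            "(\<lambda>q. Dv F q \<bullet> b) \<circ> prod.swap" "fvu \<circ> prod.swap"])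
        (use d[OF box] partials in \<open>auto simp: has_partial_swap\<close>)
    have "h * h * fuv q = h * h * fvu (prod.swap r)"
      using q(2) r(2) by linarith
    then have "fuv q = fvu (prod.swap r)"
      using \<open>h > 0\<close> by simp
    moreover have "dist (fuv q) (fuv p) < \<epsilon> / 2" "dist (fvu (prod.swap r)) (fvu p) < \<epsilon> / 2"
      using d[OF box[of q]] d[OF box[of "prod.swap r"]] q r by auto
    ultimately have "fvu p - fuv p \<le> \<epsilon>"
      unfolding dist_real_def by linarith
    then show ?thesis
      by (simp add: fvu_def fuv_def b_def inner_diff_left)
  qed
  then have "b \<bullet> b \<le> 0" by (rule field_le_epsilon)
  then have "b = 0" by (meson inner_gt_zero_iff not_le)
  then show ?thesis by (simp add: b_def)
qed

section \<open>Functions with vanishing partial derivatives\<close>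

text \<open>Every point of a ball is joined to the centre by a horizontal and a vertical segment inside the
  ball, so \<open>F\<close> is locally constant.\<close>
lemma zero_partials_imp_constant:
  assumes "open S" "connected S"
    and zero: "\<And>p. p \<in> S \<Longrightarrow> has_partial (1, 0) F 0 p" "\<And>p. p \<in> S \<Longrightarrow> has_partial (0, 1) F 0 p"
  shows "F constant_on S"
proof (rule locally_constant_imp_constant[OF \<open>connected S\<close>])
  fix a assume "a \<in> S"
  then obtain r where r: "r > 0" "ball a r \<subseteq> S"
    using \<open>open S\<close> openE by blast
  have "F x = F a" if "x \<in> ball a r" for x
  proof -
    obtain u v u' v' where a: "a = (u, v)" and x: "x = (u', v')" by (cases a, cases x)
    have lt: "sqrt ((dist u u')\<^sup>2 + (dist v v')\<^sup>2) < r"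
      using \<open>x \<in> ball a r\<close> by (simp add: a x dist_Pair_Pair)
    have sub: "(s, t) \<in> S" if "dist u s \<le> dist u u'" "dist v t \<le> dist v v'" for s t
    proof -
      have "sqrt ((dist u s)\<^sup>2 + (dist v t)\<^sup>2) \<le> sqrt ((dist u u')\<^sup>2 + (dist v v')\<^sup>2)"
        using that by (intro real_sqrt_le_mono add_mono power_mono) auto
      then have "(s, t) \<in> ball a r"
        using le_less_trans[OF _ lt] by (simp add: a dist_Pair_Pair)
      then show ?thesis using r(2) by blast
    qed
    have const: "G t = G s" if *: "\<And>r. dist s r \<le> dist s t \<Longrightarrow> (G has_vector_derivative 0) (at r)"
      for G :: "real \<Rightarrow> 'a" and s t
    proof -
      have "(G has_vector_derivative 0) (at r within closed_segment s t)"
        if "r \<in> closed_segment s t" for r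
      proof -
        have "dist s r \<le> dist s t"
          using dist_in_closed_segment(1)[OF that] by (simp add: dist_commute)
        then show ?thesis using * has_vector_derivative_at_within by blast
      qed
      then obtain c where "\<And>r. r \<in> closed_segment s t \<Longrightarrow> G r = c"
        using has_vector_derivative_zero_constant[OF convex_closed_segment] by blast
      then show ?thesis by auto
    qed
    have "F (u', v) = F (u, v)"
    proof (rule const[of u u' "\<lambda>s. F (s, v)"])
      fix s assume "dist u s \<le> dist u u'"
      then have "(s, v) \<in> S" by (rule sub) simp
      then show "((\<lambda>s. F (s, v)) has_vector_derivative 0) (at s)"
        using zero(1) has_partial_horizontal by blast
    qed
    moreover have "F (u', v') = F (u', v)"
    proof (rule const[of v v' "\<lambda>t. F (u', t)"])
      fix t assume "dist v t \<le> dist v v'"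
      then have "(u', t) \<in> S" by (intro sub) simp_all
      then show "((\<lambda>t. F (u', t)) has_vector_derivative 0) (at t)"
        using zero(2) has_partial_vertical by blast
    qed
    ultimately show ?thesis by (metis a x)
  qed
  then show "\<exists>T. openin (top_of_set S) T \<and> a \<in> T \<and> (\<forall>x\<in>T. F x = F a)"
    using r centre_in_ball open_ball open_subset by blast
qed

section \<open>Orthogonal frames and planes in three-space\<close>

text \<open>Otherwise the difference would be a fourth nonzero pairwise orthogonal vector in a
  three-dimensional space.\<close>
lemma orthogonal_frame_eqI:
  fixes A B C x y :: "real^3"
  assumes "A \<noteq> 0" "B \<noteq> 0" "C \<noteq> 0" "A \<bullet> B = 0" "A \<bullet> C = 0" "B \<bullet> C = 0"
    and "x \<bullet> A = y \<bullet> A" "x \<bullet> B = y \<bullet> B" "x \<bullet> C = y \<bullet> C"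
  shows "x = y"
proof (rule ccontr)
  assume "x \<noteq> y"
  define z where "z = x - y"
  have z: "z \<noteq> 0" "A \<bullet> z = 0" "B \<bullet> z = 0" "C \<bullet> z = 0"
    using \<open>x \<noteq> y\<close> assms by (simp_all add: z_def inner_diff_right inner_commute)
  have distinct: "A \<noteq> B" "A \<noteq> C" "A \<noteq> z" "B \<noteq> C" "B \<noteq> z" "C \<noteq> z"
    using assms z by auto
  have "pairwise orthogonal {A, B, C, z}"
    using assms z by (auto simp: pairwise_insert orthogonal_def inner_commute)
  then have "independent {A, B, C, z}"
    using assms z by (intro pairwise_orthogonal_independent) auto
  then have "card {A, B, C, z} \<le> DIM(real^3)"
    using independent_bound by blast
  then show False using distinct by simp
qed

lemma coplanar_imp_normal:
  fixes T :: "(real^3) set"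
  assumes "coplanar T"
  obtains a b where "a \<noteq> 0" "\<And>x. x \<in> T \<Longrightarrow> a \<bullet> x = b"
proof -
  obtain u v w where T: "T \<subseteq> affine hull {u, v, w}"
    using assms by (auto simp: coplanar_def)
  have "dim {v - u, w - u} \<le> card {v - u, w - u}"
    by (rule dim_le_card') simp
  also have "\<dots> \<le> 2"
    by (simp add: card_insert_if)
  finally have "dim {v - u, w - u} < DIM(real^3)"
    by simp
  then obtain a where a: "a \<noteq> 0" "\<And>y. y \<in> span {v - u, w - u} \<Longrightarrow> orthogonal a y"
    using orthogonal_to_subspace_exists by blast
  then have "a \<bullet> (v - u) = 0" "a \<bullet> (w - u) = 0"
    by (simp_all add: orthogonal_def span_base)
  then have vw: "a \<bullet> v = a \<bullet> u" "a \<bullet> w = a \<bullet> u"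
    by (simp_all add: inner_diff_right)
  have "a \<bullet> x = a \<bullet> u" if "x \<in> T" for x
  proof -
    have "x \<in> affine hull {u, v, w}"
      using T that by blast
    then obtain r s t where x: "x = r *\<^sub>R u + s *\<^sub>R v + t *\<^sub>R w" "r + s + t = 1"
      unfolding affine_hull_3 by blast
    have "a \<bullet> x = (r + s + t) * (a \<bullet> u)"
      by (simp add: x inner_add_right vw algebra_simps)
    then show ?thesis using x by simp
  qed
  with a that show thesis by blast
qed

section \<open>The Gauss-Weingarten system\<close>

text \<open>The equations from which the axial directions are found. The derivatives of \<open>N\<close> are given by
  \<open>has_partial\<close>, which asserts existence together with the value. The system is invariant under
  interchanging \<open>u\<close> with \<open>v\<close> and reversing \<open>N\<close>, so one family of curvature lines suffices.\<close>
locale gauss_weingarten =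
  fixes S :: "(real \<times> real) set"
    and X N :: "real \<times> real \<Rightarrow> real^3"
    and \<omega> :: "real \<times> real \<Rightarrow> real"
  assumes open_S: "open S" and connected_S: "connected S" and S_nonempty: "S \<noteq> {}"
    and smooth_X: "smooth_on S X" and smooth_\<omega>: "smooth_on S \<omega>"
    and Xu_Xu: "p \<in> S \<Longrightarrow> Du X p \<bullet> Du X p = exp (2 * \<omega> p)"
    and Xv_Xv: "p \<in> S \<Longrightarrow> Dv X p \<bullet> Dv X p = exp (2 * \<omega> p)"
    and Xu_Xv: "p \<in> S \<Longrightarrow> Du X p \<bullet> Dv X p = 0"
    and N_N: "p \<in> S \<Longrightarrow> N p \<bullet> N p = 1"
    and N_Xu: "p \<in> S \<Longrightarrow> N p \<bullet> Du X p = 0"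
    and N_Xv: "p \<in> S \<Longrightarrow> N p \<bullet> Dv X p = 0"
    and Xuu: "p \<in> S \<Longrightarrow> Du (Du X) p = Du \<omega> p *\<^sub>R Du X p - Dv \<omega> p *\<^sub>R Dv X p - N p"
    and Xuv: "p \<in> S \<Longrightarrow> Dv (Du X) p = Dv \<omega> p *\<^sub>R Du X p + Du \<omega> p *\<^sub>R Dv X p"
    and Xvv: "p \<in> S \<Longrightarrow> Dv (Dv X) p = - Du \<omega> p *\<^sub>R Du X p + Dv \<omega> p *\<^sub>R Dv X p + N p"
    and Nu: "p \<in> S \<Longrightarrow> has_partial (1, 0) N (exp (- 2 * \<omega> p) *\<^sub>R Du X p) p"
    and Nv: "p \<in> S \<Longrightarrow> has_partial (0, 1) N (- exp (- 2 * \<omega> p) *\<^sub>R Dv X p) p"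
    and laplace: "p \<in> S \<Longrightarrow> Du (Du \<omega>) p + Dv (Dv \<omega>) p = exp (- 2 * \<omega> p)"
    and planarity: "p \<in> S \<Longrightarrow> Dv (Du \<omega>) p = - (Du \<omega> p * Dv \<omega> p)"
begin

lemma scale_cancel: "exp (- 2 * \<omega> p) * exp (2 * \<omega> p) = 1"
  by (simp add: exp_add[symmetric])

lemma scale_solve: "exp (- 2 * \<omega> p) * x = y \<Longrightarrow> x = exp (2 * \<omega> p) * y"
  using scale_cancel[of p] by (auto simp: mult.assoc[symmetric] mult.commute[of "exp (2 * _)"])

lemma frame_nonzero:
  assumes "p \<in> S"
  shows "Du X p \<noteq> 0" "Dv X p \<noteq> 0" "N p \<noteq> 0"
  using Xu_Xu[OF assms] Xv_Xv[OF assms] N_N[OF assms] by auto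

lemmas frame_inner = Xu_Xu Xv_Xv Xu_Xv Xu_Xv[unfolded inner_commute[of "Du X _"]]
  N_N N_Xu N_Xv N_Xu[unfolded inner_commute[of "N _"]] N_Xv[unfolded inner_commute[of "N _"]]

lemma frame_eqI:
  assumes "p \<in> S" "x \<bullet> Du X p = y \<bullet> Du X p" "x \<bullet> Dv X p = y \<bullet> Dv X p" "x \<bullet> N p = y \<bullet> N p"
  shows "x = y"
  by (rule orthogonal_frame_eqI[of "Du X p" "Dv X p" "N p"])
    (use assms in \<open>simp_all add: frame_nonzero frame_inner\<close>)

lemma X_partials:
  assumes "p \<in> S"
  shows "has_partial (1, 0) (Du X) (Du \<omega> p *\<^sub>R Du X p - Dv \<omega> p *\<^sub>R Dv X p - N p) p"
    and "has_partial (0, 1) (Du X) (Dv \<omega> p *\<^sub>R Du X p + Du \<omega> p *\<^sub>R Dv X p) p"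
    and "has_partial (1, 0) (Dv X) (Dv \<omega> p *\<^sub>R Du X p + Du \<omega> p *\<^sub>R Dv X p) p"
    and "has_partial (0, 1) (Dv X) (- Du \<omega> p *\<^sub>R Du X p + Dv \<omega> p *\<^sub>R Dv X p + N p) p"
  using smooth_on_partials(3,4)[OF smooth_on_partials(1)[OF smooth_X] assms]
    smooth_on_partials(3,4)[OF smooth_on_partials(2)[OF smooth_X] assms]
  by (simp_all add: Xuu Xuv Xvv assms mixed_partials_eq[OF open_S assms smooth_X])

lemmas \<omega>_u_smooth = smooth_on_partials(1)[OF smooth_\<omega>]
lemmas \<omega>_v_smooth = smooth_on_partials(2)[OF smooth_\<omega>]
lemmas \<omega>_partials = smooth_on_partials(3,4)[OF smooth_\<omega>]
  smooth_on_partials(3,4)[OF \<omega>_u_smooth] smooth_on_partials(4)[OF \<omega>_v_smooth]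

lemma \<omega>_vu: "p \<in> S \<Longrightarrow> has_partial (1, 0) (Dv \<omega>) (Dv (Du \<omega>) p) p"
  using smooth_on_partials(3)[OF \<omega>_v_smooth, of p] mixed_partials_eq[OF open_S _ smooth_\<omega>, of p] by simp

subsection \<open>The binormal of the first curvature lines\<close>

text \<open>This is \<open>m\<close> up to a sign that depends on the orientation of the frame. Without cross products it
  is easy to differentiate, and the sign does not have to be shown to be constant.\<close>
definition binormal :: "real \<times> real \<Rightarrow> real^3" where
  "binormal p = exp (- 2 * \<omega> p) *\<^sub>R Dv X p - Dv \<omega> p *\<^sub>R N p"

text \<open>The Gauss equation for \<open>X\<^sub>u\<^sub>u\<close> gives \<open>m = e\<^sup>-\<^sup>2\<^sup>\<omega> (- \<omega>\<^sub>v X\<^sub>u \<times> X\<^sub>v - X\<^sub>u \<times> N)\<close>; its components in the frame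
  are all multiples of the triple product of the frame.\<close>
lemma m_field_eq_binormal:
  assumes "p \<in> S"
  obtains \<sigma> where "\<sigma> \<noteq> 0" "m_field X \<omega> p = \<sigma> *\<^sub>R binormal p"
proof
  define \<sigma> where "\<sigma> = exp (- 2 * \<omega> p) * (cross3 (Du X p) (Dv X p) \<bullet> N p)"
  have "cross3 (Du X p) (Dv X p) \<noteq> 0"
  proof
    assume "cross3 (Du X p) (Dv X p) = 0"
    with norm_cross_dot[of "Du X p" "Dv X p"] show False
      using assms frame_nonzero[OF assms] by (simp add: Xu_Xv)
  qed
  then show "\<sigma> \<noteq> 0"
    using frame_eqI[OF assms, of "cross3 (Du X p) (Dv X p)" 0]
    by (auto simp: \<sigma>_def dot_cross_self)
  have triple: "cross3 (Du X p) (N p) \<bullet> Dv X p = - (cross3 (Du X p) (Dv X p) \<bullet> N p)"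
    by (simp add: cross3_simps)
  have m: "m_field X \<omega> p = exp (- 2 * \<omega> p) *\<^sub>R
      (- Dv \<omega> p *\<^sub>R cross3 (Du X p) (Dv X p) - cross3 (Du X p) (N p))"
    using assms by (simp add: m_field_def Xuu Cross3.right_diff_distrib cross_mult_right)
  show "m_field X \<omega> p = \<sigma> *\<^sub>R binormal p"
    using scale_cancel[of p]
    by (intro frame_eqI[OF assms])
      (simp_all add: m binormal_def \<sigma>_def inner_diff_left frame_inner assms triple
        dot_cross_self algebra_simps)
qed

lemma m_field_perp_iff:
  assumes "p \<in> S"
  shows "m_field X \<omega> p \<bullet> w = 0 \<longleftrightarrow> binormal p \<bullet> w = 0"
  by (rule m_field_eq_binormal[OF assms]) simp

text \<open>The Gauss equation turns the coefficient \<open>e\<^sup>-\<^sup>2\<^sup>\<omega> - \<omega>\<^sub>v\<^sub>v\<close> of \<open>N\<close> into \<open>\<omega>\<^sub>u\<^sub>u\<close>.\<close>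
lemma binormal_v:
  assumes "p \<in> S"
  shows "has_partial (0, 1) binormal
    (Du (Du \<omega>) p *\<^sub>R N p - (Du \<omega> p * exp (- 2 * \<omega> p)) *\<^sub>R Du X p) p"
proof -
  have "has_partial (0, 1) binormal
     ((exp (- 2 * \<omega> p) *\<^sub>R (- Du \<omega> p *\<^sub>R Du X p + Dv \<omega> p *\<^sub>R Dv X p + N p)
        + (- 2 * Dv \<omega> p * exp (- 2 * \<omega> p)) *\<^sub>R Dv X p)
      - (Dv \<omega> p *\<^sub>R (- exp (- 2 * \<omega> p) *\<^sub>R Dv X p) + Dv (Dv \<omega>) p *\<^sub>R N p)) p"
    (is "has_partial _ _ ?D _")
    unfolding binormal_def[abs_def]
    by (intro has_partial_intros X_partials \<omega>_partials Nv assms)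
  moreover have "?D = Du (Du \<omega>) p *\<^sub>R N p - (Du \<omega> p * exp (- 2 * \<omega> p)) *\<^sub>R Du X p"
    using laplace[OF assms]
    by (intro frame_eqI[OF assms]; simp only: inner_simps frame_inner assms; simp add: algebra_simps)
  ultimately show ?thesis by simp
qed

text \<open>Planarity of the curvature lines makes the derivative along them a multiple of the binormal:
  the plane of a curvature line is the same at all of its points.\<close>
lemma binormal_u:
  assumes "p \<in> S"
  shows "has_partial (1, 0) binormal (- Du \<omega> p *\<^sub>R binormal p) p"
proof -
  have "has_partial (1, 0) binormal
     ((exp (- 2 * \<omega> p) *\<^sub>R (Dv \<omega> p *\<^sub>R Du X p + Du \<omega> p *\<^sub>R Dv X p)
        + (- 2 * Du \<omega> p * exp (- 2 * \<omega> p)) *\<^sub>R Dv X p)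
      - (Dv \<omega> p *\<^sub>R (exp (- 2 * \<omega> p) *\<^sub>R Du X p) + Dv (Du \<omega>) p *\<^sub>R N p)) p"
    (is "has_partial _ _ ?D _")
    unfolding binormal_def[abs_def]
    by (intro has_partial_intros X_partials \<omega>_partials \<omega>_vu Nu assms)
  moreover have "?D = - Du \<omega> p *\<^sub>R binormal p"
    using planarity[OF assms]
    by (intro frame_eqI[OF assms]; simp only: binormal_def inner_simps frame_inner assms;
      simp add: algebra_simps)
  ultimately show ?thesis by simp
qed

text \<open>\<open>Dv\<close> is a default value where the derivative does not exist, so orthogonality to \<open>Dv m\<close> can
  only be deduced from orthogonality to \<open>m\<close> once \<open>m\<close> is known to be differentiable.\<close>
lemma m_field_differentiable:
  assumes "p \<in> S"
  shows "has_partial (0, 1) (m_field X \<omega>) (Dv (m_field X \<omega>) p) p"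
proof -
  note X_u = smooth_on_partials(1)[OF smooth_X]
  note X_uu = smooth_on_partials(1)[OF X_u]
  have "\<exists>D. has_partial (0, 1) (m_field X \<omega>) D p"
    unfolding m_field_def
    using has_partial_scaleR[OF has_partial_exp[OF \<omega>_partials(2)]
        has_partial_cross[OF smooth_on_partials(4)[OF X_u] smooth_on_partials(4)[OF X_uu]]] assms
    by blast
  then show ?thesis by (auto dest: Dv_eqI)
qed

subsection \<open>The axial vector field is parallel\<close>

definition axial_vector :: "real \<times> real \<Rightarrow> real^3" where
  "axial_vector p = Du (Du \<omega>) p *\<^sub>R Du X p - Dv (Du \<omega>) p *\<^sub>R Dv X p + Du \<omega> p *\<^sub>R N p"

text \<open>These are the first derivatives of the planarity condition and of the Gauss equation. In the last
  one \<open>\<omega>\<^sub>v\<^sub>v\<^sub>u = \<omega>\<^sub>u\<^sub>v\<^sub>v\<close> has been eliminated with the third.\<close>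
lemma third_derivatives:
  assumes "p \<in> S"
  shows "Dv (Du (Du \<omega>)) p = - (Du \<omega> p * Dv (Du \<omega>) p + Du (Du \<omega>) p * Dv \<omega> p)"
    and "Du (Dv (Du \<omega>)) p = - (Du \<omega> p * Dv (Du \<omega>) p + Du (Du \<omega>) p * Dv \<omega> p)"
    and "Dv (Dv (Du \<omega>)) p = - (Du \<omega> p * Dv (Dv \<omega>) p + Dv (Du \<omega>) p * Dv \<omega> p)"
    and "Du (Du (Du \<omega>)) p = - 2 * Du \<omega> p * exp (- 2 * \<omega> p)
           + (Du \<omega> p * Dv (Dv \<omega>) p + Dv (Du \<omega>) p * Dv \<omega> p)"
proof -
  have "has_partial (1, 0) (\<lambda>q. - (Du \<omega> q * Dv \<omega> q))
      (- (Du \<omega> p * Dv (Du \<omega>) p + Du (Du \<omega>) p * Dv \<omega> p)) p"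
    by (intro has_partial_intros \<omega>_partials \<omega>_vu assms)
  then have "has_partial (1, 0) (Dv (Du \<omega>))
      (- (Du \<omega> p * Dv (Du \<omega>) p + Du (Du \<omega>) p * Dv \<omega> p)) p"
    by (rule has_partial_cong[OF open_S assms, rotated]) (simp add: planarity)
  then show uuv: "Du (Dv (Du \<omega>)) p = - (Du \<omega> p * Dv (Du \<omega>) p + Du (Du \<omega>) p * Dv \<omega> p)"
    by (rule Du_eqI)
  with mixed_partials_eq[OF open_S assms \<omega>_u_smooth]
  show "Dv (Du (Du \<omega>)) p = - (Du \<omega> p * Dv (Du \<omega>) p + Du (Du \<omega>) p * Dv \<omega> p)"
    by simp
  have "has_partial (0, 1) (\<lambda>q. - (Du \<omega> q * Dv \<omega> q))
      (- (Du \<omega> p * Dv (Dv \<omega>) p + Dv (Du \<omega>) p * Dv \<omega> p)) p"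
    by (intro has_partial_intros \<omega>_partials assms)
  then have "has_partial (0, 1) (Dv (Du \<omega>))
      (- (Du \<omega> p * Dv (Dv \<omega>) p + Dv (Du \<omega>) p * Dv \<omega> p)) p"
    by (rule has_partial_cong[OF open_S assms, rotated]) (simp add: planarity)
  then show uvv: "Dv (Dv (Du \<omega>)) p = - (Du \<omega> p * Dv (Dv \<omega>) p + Dv (Du \<omega>) p * Dv \<omega> p)"
    by (rule Dv_eqI)
  have "has_partial (0, 1) (Du (Dv \<omega>)) (Dv (Dv (Du \<omega>)) p) p"
    by (rule has_partial_cong[OF open_S assms, where F = "Dv (Du \<omega>)"])
      (auto simp: mixed_partials_eq[OF open_S _ smooth_\<omega>] intro!: assms
        smooth_on_partials(4) smooth_on_partials(2) \<omega>_u_smooth)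
  then have vvu: "Du (Dv (Dv \<omega>)) p = Dv (Dv (Du \<omega>)) p"
    using mixed_partials_eq[OF open_S assms \<omega>_v_smooth] Dv_eqI by metis
  have "has_partial (1, 0) (Du (Du \<omega>))
      (- 2 * Du \<omega> p * exp (- 2 * \<omega> p) - Du (Dv (Dv \<omega>)) p) p"
  proof (rule has_partial_cong[OF open_S assms])
    show "exp (- 2 * \<omega> q) - Dv (Dv \<omega>) q = Du (Du \<omega>) q" if "q \<in> S" for q
      using laplace[OF that] by simp
  qed (intro has_partial_intros \<omega>_partials assms
      smooth_on_partials(3)[OF smooth_on_partials(2)[OF \<omega>_v_smooth]])
  then show "Du (Du (Du \<omega>)) p = - 2 * Du \<omega> p * exp (- 2 * \<omega> p)
           + (Du \<omega> p * Dv (Dv \<omega>) p + Dv (Du \<omega>) p * Dv \<omega> p)"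
    using Du_eqI vvu uvv by fastforce
qed

text \<open>The components along \<open>N\<close> cancel, and the differentiated planarity condition removes the one along
  \<open>X\<^sub>v\<close>. What is left is \<open>\<omega>\<^sub>u (\<omega>\<^sub>u\<^sub>u + \<omega>\<^sub>v\<^sub>v - e\<^sup>-\<^sup>2\<^sup>\<omega>) X\<^sub>u\<close>, which the Gauss equation makes zero. In the \<open>v\<close>
  direction it is the component along \<open>X\<^sub>u\<close> that is removed, and the same factor stands before \<open>X\<^sub>v\<close>.\<close>
lemma axial_vector_u:
  assumes "p \<in> S"
  shows "has_partial (1, 0) axial_vector 0 p"
proof -
  note \<omega>_uu = smooth_on_partials(1)[OF \<omega>_u_smooth]
  note \<omega>_uv = smooth_on_partials(2)[OF \<omega>_u_smooth]
  have "has_partial (1, 0) axial_vector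
    ((Du (Du \<omega>) p *\<^sub>R (Du \<omega> p *\<^sub>R Du X p - Dv \<omega> p *\<^sub>R Dv X p - N p) + Du (Du (Du \<omega>)) p *\<^sub>R Du X p)
     - (Dv (Du \<omega>) p *\<^sub>R (Dv \<omega> p *\<^sub>R Du X p + Du \<omega> p *\<^sub>R Dv X p) + Du (Dv (Du \<omega>)) p *\<^sub>R Dv X p)
     + (Du \<omega> p *\<^sub>R (exp (- 2 * \<omega> p) *\<^sub>R Du X p) + Du (Du \<omega>) p *\<^sub>R N p)) p" (is "has_partial _ _ ?D _")
    unfolding axial_vector_def[abs_def]
    by (intro has_partial_intros X_partials \<omega>_partials Nu assms
      smooth_on_partials(3)[OF \<omega>_uu] smooth_on_partials(3)[OF \<omega>_uv])
  moreover have "?D = (Du \<omega> p * (Du (Du \<omega>) p + Dv (Dv \<omega>) p - exp (- 2 * \<omega> p))) *\<^sub>R Du X p"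
    unfolding third_derivatives[OF assms]
    by (intro frame_eqI[OF assms]; simp only: inner_simps frame_inner assms; simp add: algebra_simps)
  ultimately show ?thesis by (simp add: laplace[OF assms])
qed

lemma axial_vector_v:
  assumes "p \<in> S"
  shows "has_partial (0, 1) axial_vector 0 p"
proof -
  note \<omega>_uu = smooth_on_partials(1)[OF \<omega>_u_smooth]
  note \<omega>_uv = smooth_on_partials(2)[OF \<omega>_u_smooth]
  have "has_partial (0, 1) axial_vector
    ((Du (Du \<omega>) p *\<^sub>R (Dv \<omega> p *\<^sub>R Du X p + Du \<omega> p *\<^sub>R Dv X p) + Dv (Du (Du \<omega>)) p *\<^sub>R Du X p)
     - (Dv (Du \<omega>) p *\<^sub>R (- Du \<omega> p *\<^sub>R Du X p + Dv \<omega> p *\<^sub>R Dv X p + N p) + Dv (Dv (Du \<omega>)) p *\<^sub>R Dv X p)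
     + (Du \<omega> p *\<^sub>R (- exp (- 2 * \<omega> p) *\<^sub>R Dv X p) + Dv (Du \<omega>) p *\<^sub>R N p)) p" (is "has_partial _ _ ?D _")
    unfolding axial_vector_def[abs_def]
    by (intro has_partial_intros X_partials \<omega>_partials Nv assms
      smooth_on_partials(4)[OF \<omega>_uu] smooth_on_partials(4)[OF \<omega>_uv])
  moreover have "?D = (Du \<omega> p * (Du (Du \<omega>) p + Dv (Dv \<omega>) p - exp (- 2 * \<omega> p))) *\<^sub>R Dv X p"
    unfolding third_derivatives[OF assms]
    by (intro frame_eqI[OF assms]; simp only: inner_simps frame_inner assms; simp add: algebra_simps)
  ultimately show ?thesis by (simp add: laplace[OF assms])
qed

lemma axial_vector_constant:
  assumes "p \<in> S" "q \<in> S"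
  shows "axial_vector p = axial_vector q"
  using zero_partials_imp_constant[OF open_S connected_S axial_vector_u axial_vector_v] assms
  by (auto simp: constant_on_def)

lemma binormal_perp_axial_vector:
  assumes "p \<in> S"
  shows "binormal p \<bullet> axial_vector p = 0"
  using assms planarity[OF assms] scale_cancel[of p]
  by (simp add: binormal_def axial_vector_def inner_diff_left inner_diff_right inner_add_right frame_inner)

lemma perp_derivative:
  assumes "p \<in> S" "\<And>q. q \<in> S \<Longrightarrow> F q \<bullet> w = (0::real)" "has_partial e F D p"
  shows "D \<bullet> w = 0"
proof -
  have "has_partial e (\<lambda>q. F q \<bullet> w) (D \<bullet> w) p"
    using has_partial_inner[OF assms(3) has_partial_const[of e w p]] by simp
  then have "has_partial e (\<lambda>_. 0) (D \<bullet> w) p"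
    by (rule has_partial_cong[OF open_S assms(1), rotated]) (simp add: assms(2))
  then show ?thesis using has_partial_const has_partial_unique by blast
qed

text \<open>Orthogonality to \<open>b\<close> fixes \<open>\<langle>w, X\<^sub>v\<rangle>\<close> in terms of \<open>\<langle>w, N\<rangle>\<close>, and orthogonality to \<open>b\<^sub>v\<close> fixes
  \<open>\<langle>w, X\<^sub>u\<rangle>\<close>, provided that \<open>\<omega>\<^sub>u \<noteq> 0\<close>. So \<open>w\<close> has one free component, and the scalar is read off from
  \<open>\<langle>v\<^sub>1, N\<rangle> = \<omega>\<^sub>u\<close>.\<close>
lemma perp_binormal_imp_parallel_axial_vector:
  assumes w: "\<And>q. q \<in> S \<Longrightarrow> binormal q \<bullet> w = 0" and p: "p \<in> S" and "Du \<omega> p \<noteq> 0"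
  shows "w = ((w \<bullet> N p) / Du \<omega> p) *\<^sub>R axial_vector p"
proof -
  have "exp (- 2 * \<omega> p) * (w \<bullet> Dv X p) = Dv \<omega> p * (w \<bullet> N p)"
    using w[OF p] by (simp add: binormal_def inner_diff_left inner_commute[of w])
  then have v: "w \<bullet> Dv X p = exp (2 * \<omega> p) * (Dv \<omega> p * (w \<bullet> N p))"
    by (rule scale_solve)
  have "exp (- 2 * \<omega> p) * (Du \<omega> p * (w \<bullet> Du X p)) = Du (Du \<omega>) p * (w \<bullet> N p)"
    using perp_derivative[OF p w binormal_v[OF p]]
    by (simp add: inner_diff_left inner_commute[of w] algebra_simps)
  then have u: "Du \<omega> p * (w \<bullet> Du X p) = exp (2 * \<omega> p) * (Du (Du \<omega>) p * (w \<bullet> N p))"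
    by (rule scale_solve)
  show ?thesis
    using \<open>Du \<omega> p \<noteq> 0\<close> u v
    by (intro frame_eqI[OF p])
      (simp_all add: axial_vector_def inner_diff_left inner_add_left frame_inner p planarity field_simps)
qed

lemma axial_direction_1_axial_vector:
  assumes p: "p \<in> S" and "Du \<omega> p \<noteq> 0"
  shows "axial_direction_1 S X \<omega> (axial_vector p)"
  unfolding axial_direction_1_def unique_direction_def
proof (intro conjI allI ballI impI)
  have "axial_vector p \<bullet> N p = Du \<omega> p"
    using p by (simp add: axial_vector_def inner_diff_left inner_add_left frame_inner)
  then show "axial_vector p \<noteq> 0"
    using \<open>Du \<omega> p \<noteq> 0\<close> by auto
  show m: "m_field X \<omega> q \<bullet> axial_vector p = 0" if "q \<in> S" for q
    using binormal_perp_axial_vector[OF that] axial_vector_constant[OF p that] that by (simp add: m_field_perp_iff)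
  show "Dv (m_field X \<omega>) q \<bullet> axial_vector p = 0" if "q \<in> S" for q
    by (rule perp_derivative[OF that m m_field_differentiable[OF that]])
  fix w
  assume w: "w \<noteq> 0 \<and> (\<forall>q\<in>S. m_field X \<omega> q \<bullet> w = 0 \<and> Dv (m_field X \<omega>) q \<bullet> w = 0)"
  then have "w = ((w \<bullet> N p) / Du \<omega> p) *\<^sub>R axial_vector p"
    by (intro perp_binormal_imp_parallel_axial_vector p \<open>Du \<omega> p \<noteq> 0\<close>) (simp add: m_field_perp_iff[symmetric])
  with w show "\<exists>c. c \<noteq> 0 \<and> w = c *\<^sub>R axial_vector p"
    by (metis scaleR_zero_left)
qed

text \<open>If \<open>\<omega>\<^sub>u\<close> vanishes identically, the binormal is constant and its orthogonal complement is a plane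
  of solutions, so uniqueness of the direction fails.\<close>
lemma axial_direction_1_imp_nonzero:
  assumes v: "axial_direction_1 S X \<omega> v"
  obtains p where "p \<in> S" "Du \<omega> p \<noteq> 0"
proof (rule ccontr)
  assume "\<not> thesis"
  with that have zero: "Du \<omega> q = 0" if "q \<in> S" for q using that by blast
  have uu: "Du (Du \<omega>) q = 0" if "q \<in> S" for q
    using has_partial_cong[OF open_S that _ has_partial_const[of "(1, 0)" 0 q], of "Du \<omega>"] zero
    by (auto intro: Du_eqI)
  have "binormal constant_on S"
    using binormal_u binormal_v zero uu
    by (intro zero_partials_imp_constant open_S connected_S) fastforce+
  then obtain b where b: "\<And>q. q \<in> S \<Longrightarrow> binormal q = b"
    by (auto simp: constant_on_def)
  obtain p where p: "p \<in> S" using S_nonempty by auto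
  have "binormal p \<bullet> Dv X p = 1"
    using p scale_cancel[of p] by (simp add: binormal_def inner_diff_left frame_inner)
  then have "b \<noteq> 0" using b[OF p] by auto
  have perp: "b \<bullet> v = 0" "v \<noteq> 0"
    using v p b[OF p] by (auto simp: axial_direction_1_def unique_direction_def m_field_perp_iff)
  \<comment> \<open>A second solution, orthogonal to the given one.\<close>
  define w where "w = cross3 v b"
  have "w \<noteq> 0"
    using norm_cross_dot[of v b] perp \<open>b \<noteq> 0\<close> by (auto simp: w_def inner_commute)
  have w: "m_field X \<omega> q \<bullet> w = 0" if "q \<in> S" for q
    using that b[OF that] by (simp add: m_field_perp_iff w_def dot_cross_self)
  then have "Dv (m_field X \<omega>) q \<bullet> w = 0" if "q \<in> S" for q
    using perp_derivative[OF that _ m_field_differentiable[OF that]] by blast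
  with w \<open>w \<noteq> 0\<close> v obtain c where "c \<noteq> 0" "w = c *\<^sub>R v"
    by (auto simp: axial_direction_1_def unique_direction_def)
  moreover have "w \<bullet> v = 0" by (simp add: w_def dot_cross_self)
  ultimately show False using perp by simp
qed

lemma axial_direction_1_parallel_axial_vector:
  assumes "axial_direction_1 S X \<omega> v" "p \<in> S"
  obtains c where "v = c *\<^sub>R axial_vector p"
proof -
  obtain q where q: "q \<in> S" "Du \<omega> q \<noteq> 0"
    using axial_direction_1_imp_nonzero[OF assms(1)] .
  have "axial_direction_1 S X \<omega> (axial_vector p)"
    using axial_direction_1_axial_vector[OF q] axial_vector_constant[OF q(1) assms(2)] by simp
  with assms(1) that show thesis
    unfolding axial_direction_1_def unique_direction_def by blast
qed

end

section \<open>Interchanging the two families of curvature lines\<close>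

text \<open>Since the principal curvatures are opposite, interchanging the coordinates also interchanges
  their signs; reversing the normal restores them.\<close>
lemma (in gauss_weingarten) swapped:
  "gauss_weingarten (prod.swap -` S) (X \<circ> prod.swap) (\<lambda>p. - N (prod.swap p)) (\<omega> \<circ> prod.swap)"
proof
  show "open (prod.swap -` S)"
    using open_S by (auto intro!: open_vimage continuous_on_swap)
  have "prod.swap -` S = prod.swap ` S"
    by force
  then show "connected (prod.swap -` S)"
    using connected_S by (auto intro!: connected_continuous_image continuous_on_swap)
  show "prod.swap -` S \<noteq> {}"
    using S_nonempty by (metis empty_iff ex_in_conv swap_swap vimageI2)
  show "smooth_on (prod.swap -` S) (X \<circ> prod.swap)" "smooth_on (prod.swap -` S) (\<omega> \<circ> prod.swap)"
    using smooth_X smooth_\<omega> by (auto intro: smooth_on_swap)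
  fix p assume "p \<in> prod.swap -` S"
  then have p: "prod.swap p \<in> S" by simp
  note swap = Du_swap Dv_swap o_apply
  note flip = mixed_partials_eq[OF open_S p smooth_X] mixed_partials_eq[OF open_S p smooth_\<omega>]
  let ?q = "prod.swap p"
  show "Du (X \<circ> prod.swap) p \<bullet> Du (X \<circ> prod.swap) p = exp (2 * (\<omega> \<circ> prod.swap) p)"
    "Dv (X \<circ> prod.swap) p \<bullet> Dv (X \<circ> prod.swap) p = exp (2 * (\<omega> \<circ> prod.swap) p)"
    "Du (X \<circ> prod.swap) p \<bullet> Dv (X \<circ> prod.swap) p = 0"
    "- N ?q \<bullet> - N ?q = 1"
    "- N ?q \<bullet> Du (X \<circ> prod.swap) p = 0"
    "- N ?q \<bullet> Dv (X \<circ> prod.swap) p = 0"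
    using p by (simp_all add: swap frame_inner)
  show "Du (Du (X \<circ> prod.swap)) p = Du (\<omega> \<circ> prod.swap) p *\<^sub>R Du (X \<circ> prod.swap) p
      - Dv (\<omega> \<circ> prod.swap) p *\<^sub>R Dv (X \<circ> prod.swap) p - - N ?q"
    "Dv (Du (X \<circ> prod.swap)) p = Dv (\<omega> \<circ> prod.swap) p *\<^sub>R Du (X \<circ> prod.swap) p
      + Du (\<omega> \<circ> prod.swap) p *\<^sub>R Dv (X \<circ> prod.swap) p"
    "Dv (Dv (X \<circ> prod.swap)) p = - Du (\<omega> \<circ> prod.swap) p *\<^sub>R Du (X \<circ> prod.swap) p
      + Dv (\<omega> \<circ> prod.swap) p *\<^sub>R Dv (X \<circ> prod.swap) p + - N ?q"
    unfolding swap flip Xuu[OF p] Xuv[OF p] Xvv[OF p] by simp_all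
  show "Du (Du (\<omega> \<circ> prod.swap)) p + Dv (Dv (\<omega> \<circ> prod.swap)) p = exp (- 2 * (\<omega> \<circ> prod.swap) p)"
    using laplace[OF p] by (simp add: swap add.commute)
  show "Dv (Du (\<omega> \<circ> prod.swap)) p = - (Du (\<omega> \<circ> prod.swap) p * Dv (\<omega> \<circ> prod.swap) p)"
    using planarity[OF p] by (simp add: swap flip)
  have "has_partial (1, 0) (N \<circ> prod.swap) (- exp (- 2 * \<omega> ?q) *\<^sub>R Dv X ?q) p"
    "has_partial (0, 1) (N \<circ> prod.swap) (exp (- 2 * \<omega> ?q) *\<^sub>R Du X ?q) p"
    using Nu[OF p] Nv[OF p] by (simp_all only: has_partial_swap)
  from this[THEN has_partial_minus]
  show "has_partial (1, 0) (\<lambda>p. - N (prod.swap p))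
      (exp (- 2 * (\<omega> \<circ> prod.swap) p) *\<^sub>R Du (X \<circ> prod.swap) p) p"
    "has_partial (0, 1) (\<lambda>p. - N (prod.swap p))
      (- exp (- 2 * (\<omega> \<circ> prod.swap) p) *\<^sub>R Dv (X \<circ> prod.swap) p) p"
    by (simp_all add: swap)
qed

lemma axial_direction_2_swap:
  "axial_direction_2 S X \<omega> = axial_direction_1 (prod.swap -` S) (X \<circ> prod.swap) (\<omega> \<circ> prod.swap)"
proof -
  have m: "m_field (X \<circ> prod.swap) (\<omega> \<circ> prod.swap) = n_field X \<omega> \<circ> prod.swap"
    by (simp add: m_field_def n_field_def Du_swap fun_eq_iff)
  have ball: "(\<forall>p\<in>prod.swap -` S. P (prod.swap p)) \<longleftrightarrow> (\<forall>p\<in>S. P p)"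
    for P :: "real \<times> real \<Rightarrow> bool"
    by (metis swap_swap vimage_eq)
  show ?thesis
    unfolding axial_direction_1_def axial_direction_2_def m Dv_swap o_apply
    using ball[of "\<lambda>p. n_field X \<omega> p \<bullet> w = 0 \<and> Du (n_field X \<omega>) p \<bullet> w = 0" for w]
    by presburger
qed

text \<open>The interchange of coordinates reverses the normal, so the axial vector of the interchanged
  surface is \<open>-v\<^sub>2\<close>; the sign has to be corrected.\<close>
lemma unique_direction_minus:
  assumes "unique_direction P w" "P (- w)"
  shows "unique_direction P (- w)"
  unfolding unique_direction_def
proof (intro conjI allI impI)
  show "- w \<noteq> 0" "P (- w)"
    using assms by (simp_all add: unique_direction_def)
  fix w' assume "w' \<noteq> 0 \<and> P w'"
  then obtain c where "c \<noteq> 0" "w' = c *\<^sub>R w"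
    using assms by (auto simp: unique_direction_def)
  then show "\<exists>c. c \<noteq> 0 \<and> w' = c *\<^sub>R - w"
    by (intro exI[of _ "- c"]) simp
qed

lemma axial_direction_1_minus:
  assumes "axial_direction_1 S X \<omega> w"
  shows "axial_direction_1 S X \<omega> (- w)"
  using assms unfolding axial_direction_1_def
  by (rule unique_direction_minus) (use assms in \<open>auto simp: axial_direction_1_def unique_direction_def\<close>)

section \<open>The structure equations of a minimal surface with planar curvature lines\<close>

text \<open>The second derivatives of \<open>X\<close> are found by pairing them with the frame: the tangential parts come
  from differentiating the conformality relations, the normal parts from the real and imaginary part
  of the Hopf factor and from minimality. Differentiating the orthogonality relations of \<open>N\<close> yields
  the Weingarten equations. The Gauss equation is the \<open>X\<^sub>v\<close> component of \<open>(X\<^sub>u\<^sub>u)\<^sub>v = (X\<^sub>u\<^sub>v)\<^sub>u\<close>.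

  The equation \<open>\<omega>\<^sub>u\<^sub>v + \<omega>\<^sub>u \<omega>\<^sub>v = 0\<close> comes from planarity: a normal \<open>a\<close> of the plane of a
  \<open>u\<close>-line annihilates \<open>X\<^sub>u\<close>, \<open>X\<^sub>u\<^sub>u\<close> and \<open>X\<^sub>u\<^sub>u\<^sub>u\<close>. The first two conditions leave for \<open>a\<close> only multiples of
  one vector with nonzero \<open>X\<^sub>v\<close> component, and the third is then the equation times that component.\<close>
lemma gauss_weingarten_of_surface:
  assumes S: "open S" "connected S" "S \<noteq> {}"
    and conf: "conformal_immersion S X \<omega>"
    and normal: "unit_normal_field S X N"
    and minimal: "minimal_surface S X N"
    and hopf: "\<forall>p\<in>S. hopf_factor X N p = - 1 / 2"
    and planar: "planar_curvature_lines S X"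
  shows "gauss_weingarten S X N \<omega>"
proof -
  have X: "smooth_on S X" and \<omega>: "smooth_on S \<omega>" and N: "smooth_on S N"
    using conf normal by (simp_all add: conformal_immersion_def unit_normal_field_def)
  note X_u = smooth_on_partials(1)[OF X] and X_v = smooth_on_partials(2)[OF X]
  have metric: "Du X p \<bullet> Du X p = exp (2 * \<omega> p)" "Dv X p \<bullet> Dv X p = exp (2 * \<omega> p)"
    "Du X p \<bullet> Dv X p = 0" "Dv X p \<bullet> Du X p = 0" if "p \<in> S" for p
    using conf that by (simp_all add: conformal_immersion_def inner_commute)
  have N_unit: "N p \<bullet> N p = 1" "N p \<bullet> Du X p = 0" "N p \<bullet> Dv X p = 0"
    "Du X p \<bullet> N p = 0" "Dv X p \<bullet> N p = 0" if "p \<in> S" for p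
    using normal that by (simp_all add: unit_normal_field_def dot_square_norm inner_commute)
  have frame: "x = y" if "p \<in> S" "x \<bullet> Du X p = y \<bullet> Du X p" "x \<bullet> Dv X p = y \<bullet> Dv X p" "x \<bullet> N p = y \<bullet> N p"
    for x y p
    using orthogonal_frame_eqI[of "Du X p" "Dv X p" "N p" x y] metric[OF \<open>p \<in> S\<close>] N_unit[OF \<open>p \<in> S\<close>] that(2-)
    by fastforce
  have scale: "exp (- 2 * \<omega> p) * exp (2 * \<omega> p) = 1" for p
    by (simp add: exp_add[symmetric])
  have partials: "has_partial (1, 0) X (Du X p) p" "has_partial (0, 1) X (Dv X p) p"
    "has_partial (1, 0) (Du X) (Du (Du X) p) p" "has_partial (0, 1) (Du X) (Dv (Du X) p) p"
    "has_partial (1, 0) (Dv X) (Dv (Du X) p) p" "has_partial (0, 1) (Dv X) (Dv (Dv X) p) p"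
    "has_partial (1, 0) \<omega> (Du \<omega> p) p" "has_partial (0, 1) \<omega> (Dv \<omega> p) p"
    "has_partial (1, 0) (Du \<omega>) (Du (Du \<omega>) p) p" "has_partial (0, 1) (Du \<omega>) (Dv (Du \<omega>) p) p"
    "has_partial (1, 0) (Dv \<omega>) (Dv (Du \<omega>) p) p" "has_partial (0, 1) (Dv \<omega>) (Dv (Dv \<omega>) p) p"
    "has_partial (1, 0) N (Du N p) p" "has_partial (0, 1) N (Dv N p) p" if "p \<in> S" for p
    using smooth_on_partials(3,4)[OF X that] smooth_on_partials(3,4)[OF X_u that]
      smooth_on_partials(3,4)[OF X_v that] smooth_on_partials(3,4)[OF \<omega> that]
      smooth_on_partials(3,4)[OF smooth_on_partials(1)[OF \<omega>] that]
      smooth_on_partials(3,4)[OF smooth_on_partials(2)[OF \<omega>] that]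
      smooth_on_partials(3,4)[OF N that]
      mixed_partials_eq[OF S(1) that X] mixed_partials_eq[OF S(1) that \<omega>]
    by simp_all
  \<comment> \<open>Every relation between inner products of the frame is differentiated in this way.\<close>
  have product: "F p \<bullet> D' + D \<bullet> G p = d"
    if p: "p \<in> S" and eq: "\<And>q. q \<in> S \<Longrightarrow> F q \<bullet> G q = h q" and h: "has_partial e h d p"
      and F: "has_partial e F D p" and G: "has_partial e G D' p"
    for p e F G h d D D'
  proof -
    have "has_partial e h (F p \<bullet> D' + D \<bullet> G p) p"
      by (rule has_partial_cong[OF S(1) p _ has_partial_inner[OF F G]]) (rule eq)
    with h show ?thesis by (rule has_partial_unique[symmetric])
  qed
  have const: "has_partial e (\<lambda>_. c :: real) 0 p" for e c p
    by (rule has_partial_const)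

  have second_form: "Du (Du X) p \<bullet> N p = - 1" "Dv (Du X) p \<bullet> N p = 0" "Dv (Dv X) p \<bullet> N p = 1"
    if p: "p \<in> S" for p
  proof -
    have h: "hopf_factor X N p = - 1 / 2" using hopf p by blast
    have "Re (hopf_factor X N p) = - 1 / 2" "Im (hopf_factor X N p) = 0"
      by (simp_all add: h)
    then have "Du (Du X) p \<bullet> N p - Dv (Dv X) p \<bullet> N p = - 2" and M: "Dv (Du X) p \<bullet> N p = 0"
      by (simp_all add: hopf_factor_def)
    moreover have "Du (Du X) p \<bullet> N p + Dv (Dv X) p \<bullet> N p = 0"
    proof -
      have "(Du (Du X) p \<bullet> N p * exp (2 * \<omega> p) + Dv (Dv X) p \<bullet> N p * exp (2 * \<omega> p)) = 0"
        using minimal p by (simp add: minimal_surface_def mean_curvature_def Let_def metric)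
      then have "(Du (Du X) p \<bullet> N p + Dv (Dv X) p \<bullet> N p) * exp (2 * \<omega> p) = 0"
        by (simp add: distrib_right)
      then show ?thesis by simp
    qed
    ultimately show "Du (Du X) p \<bullet> N p = - 1" "Dv (Du X) p \<bullet> N p = 0" "Dv (Dv X) p \<bullet> N p = 1"
      by linarith+
  qed

  have tangential:
    "Du (Du X) p \<bullet> Du X p = Du \<omega> p * exp (2 * \<omega> p)" "Dv (Du X) p \<bullet> Du X p = Dv \<omega> p * exp (2 * \<omega> p)"
    "Dv (Du X) p \<bullet> Dv X p = Du \<omega> p * exp (2 * \<omega> p)" "Dv (Dv X) p \<bullet> Dv X p = Dv \<omega> p * exp (2 * \<omega> p)"
    "Du (Du X) p \<bullet> Dv X p = - Dv \<omega> p * exp (2 * \<omega> p)" "Dv (Dv X) p \<bullet> Du X p = - Du \<omega> p * exp (2 * \<omega> p)"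
    if p: "p \<in> S" for p
  proof -
    note d = partials[OF p]
    note exp = has_partial_exp[OF d(7), of 2] has_partial_exp[OF d(8), of 2]
    show *: "Du (Du X) p \<bullet> Du X p = Du \<omega> p * exp (2 * \<omega> p)" "Dv (Du X) p \<bullet> Du X p = Dv \<omega> p * exp (2 * \<omega> p)"
      "Dv (Du X) p \<bullet> Dv X p = Du \<omega> p * exp (2 * \<omega> p)" "Dv (Dv X) p \<bullet> Dv X p = Dv \<omega> p * exp (2 * \<omega> p)"
      using product[OF p metric(1) exp(1) d(3) d(3)] product[OF p metric(1) exp(2) d(4) d(4)]
        product[OF p metric(2) exp(1) d(5) d(5)] product[OF p metric(2) exp(2) d(6) d(6)]
      by (simp_all add: inner_commute)
    show "Du (Du X) p \<bullet> Dv X p = - Dv \<omega> p * exp (2 * \<omega> p)" "Dv (Dv X) p \<bullet> Du X p = - Du \<omega> p * exp (2 * \<omega> p)"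
      using product[OF p metric(3) const d(3) d(5)] product[OF p metric(3) const d(4) d(6)] *
      by (simp_all add: inner_commute)
  qed

  have Xuu: "Du (Du X) p = Du \<omega> p *\<^sub>R Du X p - Dv \<omega> p *\<^sub>R Dv X p - N p"
    and Xuv: "Dv (Du X) p = Dv \<omega> p *\<^sub>R Du X p + Du \<omega> p *\<^sub>R Dv X p"
    and Xvv: "Dv (Dv X) p = - Du \<omega> p *\<^sub>R Du X p + Dv \<omega> p *\<^sub>R Dv X p + N p" if p: "p \<in> S" for p
    by (rule frame[OF p];
      simp add: inner_simps metric[OF p] N_unit[OF p] second_form[OF p] tangential[OF p])+

  have Nu: "Du N p = exp (- 2 * \<omega> p) *\<^sub>R Du X p" and Nv: "Dv N p = - exp (- 2 * \<omega> p) *\<^sub>R Dv X p"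
    if p: "p \<in> S" for p
  proof -
    note d = partials[OF p]
    have "Du N p \<bullet> N p = 0" "Du N p \<bullet> Du X p = 1" "Du N p \<bullet> Dv X p = 0"
      using product[OF p N_unit(1) const d(13) d(13)] product[OF p N_unit(2) const d(13) d(3)]
        product[OF p N_unit(3) const d(13) d(5)] second_form[OF p]
      by (simp_all add: inner_commute)
    then show "Du N p = exp (- 2 * \<omega> p) *\<^sub>R Du X p"
      using scale[of p] by (intro frame[OF p]) (simp_all add: metric[OF p] N_unit[OF p])
    have "Dv N p \<bullet> N p = 0" "Dv N p \<bullet> Du X p = 0" "Dv N p \<bullet> Dv X p = - 1"
      using product[OF p N_unit(1) const d(14) d(14)] product[OF p N_unit(2) const d(14) d(4)]
        product[OF p N_unit(3) const d(14) d(6)] second_form[OF p]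
      by (simp_all add: inner_commute)
    then show "Dv N p = - exp (- 2 * \<omega> p) *\<^sub>R Dv X p"
      using scale[of p] by (intro frame[OF p]) (simp_all add: metric[OF p] N_unit[OF p])
  qed

  have laplace: "Du (Du \<omega>) p + Dv (Dv \<omega>) p = exp (- 2 * \<omega> p)" if p: "p \<in> S" for p
  proof -
    note d = partials[OF p]
    have "has_partial (0, 1) (\<lambda>q. Du \<omega> q *\<^sub>R Du X q - Dv \<omega> q *\<^sub>R Dv X q - N q)
       ((Du \<omega> p *\<^sub>R Dv (Du X) p + Dv (Du \<omega>) p *\<^sub>R Du X p)
        - (Dv \<omega> p *\<^sub>R Dv (Dv X) p + Dv (Dv \<omega>) p *\<^sub>R Dv X p) - Dv N p) p" (is "has_partial _ _ ?A _")
      by (intro has_partial_intros d)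
    then have "has_partial (0, 1) (Du (Du X)) ?A p"
      by (rule has_partial_cong[OF S(1) p, rotated]) (simp add: Xuu)
    then have A: "Dv (Du (Du X)) p = ?A" by (rule Dv_eqI)
    have "has_partial (1, 0) (\<lambda>q. Dv \<omega> q *\<^sub>R Du X q + Du \<omega> q *\<^sub>R Dv X q)
       ((Dv \<omega> p *\<^sub>R Du (Du X) p + Dv (Du \<omega>) p *\<^sub>R Du X p)
        + (Du \<omega> p *\<^sub>R Dv (Du X) p + Du (Du \<omega>) p *\<^sub>R Dv X p)) p" (is "has_partial _ _ ?B _")
      by (intro has_partial_intros d)
    then have "has_partial (1, 0) (Dv (Du X)) ?B p"
      by (rule has_partial_cong[OF S(1) p, rotated]) (simp add: Xuv)
    then have B: "Du (Dv (Du X)) p = ?B" by (rule Du_eqI)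
    have "?A \<bullet> Dv X p = ?B \<bullet> Dv X p"
      using mixed_partials_eq[OF S(1) p X_u] by (simp only: A B)
    then have "exp (2 * \<omega> p) * (Du (Du \<omega>) p + Dv (Dv \<omega>) p) = exp (- 2 * \<omega> p) * exp (2 * \<omega> p)"
      by (simp only: inner_simps tangential[OF p] metric[OF p] Nv[OF p]) (simp add: algebra_simps)
    then show ?thesis by (simp add: mult.commute)
  qed

  have planarity: "Dv (Du \<omega>) p = - (Du \<omega> p * Dv \<omega> p)" if p: "p \<in> S" for p
  proof -
    note d = partials[OF p]
    obtain u v where uv: "p = (u, v)" by (cases p)
    obtain r where r: "r > 0" "cball p r \<subseteq> S"
      using S(1) p open_contains_cball by blast
    have seg: "{u - r..u + r} \<times> {v} \<subseteq> S"
    proof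
      fix q assume "q \<in> {u - r..u + r} \<times> {v}"
      then have "q \<in> cball p r"
        by (auto simp: uv dist_Pair_Pair dist_real_def)
      with r(2) show "q \<in> S" by blast
    qed
    then have "coplanar (X ` ({u - r..u + r} \<times> {v}))"
      using planar by (simp add: planar_curvature_lines_def)
    then obtain a b where a: "a \<noteq> 0" "\<And>x. x \<in> X ` ({u - r..u + r} \<times> {v}) \<Longrightarrow> a \<bullet> x = b"
      using coplanar_imp_normal by blast
    \<comment> \<open>Functions with constant product with \<open>a\<close> have derivatives orthogonal to \<open>a\<close>; iterating this
      from \<open>X\<close> reaches \<open>X\<^sub>u\<^sub>u\<^sub>u\<close>.\<close>
    have perp_step: "a \<bullet> Du F (s, v) = 0"
      if F: "smooth_on S F" and c: "\<And>s. s \<in> {u - r<..<u + r} \<Longrightarrow> a \<bullet> F (s, v) = c"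
        and s: "s \<in> {u - r<..<u + r}" for F s c
    proof -
      have "(s, v) \<in> S" using seg s by auto
      then have "((\<lambda>s. F (s, v)) has_vector_derivative Du F (s, v)) (at s)"
        using smooth_on_partials(3)[OF F] has_partial_horizontal by blast
      then have "((\<lambda>s. a \<bullet> F (s, v)) has_vector_derivative a \<bullet> Du F (s, v)) (at s)"
        by (rule bounded_linear.has_vector_derivative[OF bounded_linear_inner_right])
      then have "((\<lambda>s. c) has_vector_derivative a \<bullet> Du F (s, v)) (at s)"
        by (rule has_vector_derivative_transform_within_open[OF _ open_greaterThanLessThan s]) (rule c)
      then show ?thesis
        using vector_derivative_unique_at has_vector_derivative_const by blast
    qed
    have u_in: "u \<in> {u - r<..<u + r}" using r(1) by simp
    have 1: "a \<bullet> Du X (s, v) = 0" if "s \<in> {u - r<..<u + r}" for s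
      by (rule perp_step[OF X _ that, of b]) (auto intro!: a(2))
    have 2: "a \<bullet> Du (Du X) (s, v) = 0" if "s \<in> {u - r<..<u + r}" for s
      by (rule perp_step[OF X_u 1 that])
    have 3: "a \<bullet> Du (Du (Du X)) p = 0"
      unfolding uv by (rule perp_step[OF smooth_on_partials(1)[OF X_u] 2 u_in])
    have "has_partial (1, 0) (\<lambda>q. Du \<omega> q *\<^sub>R Du X q - Dv \<omega> q *\<^sub>R Dv X q - N q)
       ((Du \<omega> p *\<^sub>R Du (Du X) p + Du (Du \<omega>) p *\<^sub>R Du X p)
        - (Dv \<omega> p *\<^sub>R Dv (Du X) p + Dv (Du \<omega>) p *\<^sub>R Dv X p) - Du N p) p" (is "has_partial _ _ ?A _")
      by (intro has_partial_intros d)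
    then have "has_partial (1, 0) (Du (Du X)) ?A p"
      by (rule has_partial_cong[OF S(1) p, rotated]) (simp add: Xuu)
    then have A: "Du (Du (Du X)) p = ?A" by (rule Du_eqI)
    have a_u: "a \<bullet> Du X p = 0" and "a \<bullet> Du (Du X) p = 0"
      using 1[OF u_in] 2[OF u_in] by (simp_all add: uv)
    then have a_N: "a \<bullet> N p = - Dv \<omega> p * (a \<bullet> Dv X p)"
      by (simp add: Xuu[OF p] inner_simps)
    have "a \<bullet> Dv X p \<noteq> 0"
      using frame[OF p, of a 0] a(1) a_u a_N by auto
    moreover have "(Dv (Du \<omega>) p + Du \<omega> p * Dv \<omega> p) * (a \<bullet> Dv X p) = 0"
      using 3 unfolding A Xuu[OF p] Xuv[OF p] Nu[OF p]
      by (simp only: inner_simps a_u a_N) (simp add: algebra_simps)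
    ultimately show ?thesis by simp
  qed

  show ?thesis
    by unfold_locales
      (use S X \<omega> metric N_unit Xuu Xuv Xvv laplace planarity partials(13,14) in \<open>auto simp: Nu Nv\<close>)
qed

theorem proposition2p2:
  fixes \<Sigma> :: "(real \<times> real) set"
    and X N :: "real \<times> real \<Rightarrow> real^3"
    and \<omega> :: "real \<times> real \<Rightarrow> real"
  assumes "open \<Sigma>" "connected \<Sigma>" "\<Sigma> \<noteq> {}" "simply_connected \<Sigma>"
    and "conformal_immersion \<Sigma> X \<omega>"
    and "unit_normal_field \<Sigma> X N"
    and "minimal_surface \<Sigma> X N"
    and "\<not> coplanar (X ` \<Sigma>)"
    and "\<forall>p\<in>\<Sigma>. \<not> umbilic X N p"
    and "curvature_line_coordinates \<Sigma> X N"
    and "\<forall>p\<in>\<Sigma>. hopf_factor X N p = - 1 / 2"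
    and "planar_curvature_lines \<Sigma> X"
  shows
    "((\<exists>p\<in>\<Sigma>. exp (\<omega> p) * Du \<omega> p \<noteq> 0) \<longrightarrow>
       (\<exists>v1. axial_direction_1 \<Sigma> X \<omega> v1 \<and>
         (\<forall>p\<in>\<Sigma>. v1 = Du (Du \<omega>) p *\<^sub>R Du X p - Dv (Du \<omega>) p *\<^sub>R Dv X p + Du \<omega> p *\<^sub>R N p))) \<and>
     ((\<exists>p\<in>\<Sigma>. exp (\<omega> p) * Dv \<omega> p \<noteq> 0) \<longrightarrow>
       (\<exists>v2. axial_direction_2 \<Sigma> X \<omega> v2 \<and>
         (\<forall>p\<in>\<Sigma>. v2 = Dv (Du \<omega>) p *\<^sub>R Du X p - Dv (Dv \<omega>) p *\<^sub>R Dv X p + Dv \<omega> p *\<^sub>R N p))) \<and>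
     (\<forall>v1 v2. axial_direction_1 \<Sigma> X \<omega> v1 \<and> axial_direction_2 \<Sigma> X \<omega> v2 \<longrightarrow> orthogonal v1 v2)"
proof -
  interpret gauss_weingarten \<Sigma> X N \<omega>
    using assms by (intro gauss_weingarten_of_surface)
  interpret swapped: gauss_weingarten "prod.swap -` \<Sigma>" "X \<circ> prod.swap"
    "\<lambda>p. - N (prod.swap p)" "\<omega> \<circ> prod.swap"
    by (rule swapped)
  have swapped_vector: "- swapped.axial_vector (prod.swap p) =
      Dv (Du \<omega>) p *\<^sub>R Du X p - Dv (Dv \<omega>) p *\<^sub>R Dv X p + Dv \<omega> p *\<^sub>R N p" if "p \<in> \<Sigma>" for p
    by (simp add: swapped.axial_vector_def Du_swap Dv_swap
      mixed_partials_eq[OF open_S that smooth_\<omega>])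
  have first: "\<exists>v1. axial_direction_1 \<Sigma> X \<omega> v1 \<and>
      (\<forall>p\<in>\<Sigma>. v1 = Du (Du \<omega>) p *\<^sub>R Du X p - Dv (Du \<omega>) p *\<^sub>R Dv X p + Du \<omega> p *\<^sub>R N p)"
    if p: "p \<in> \<Sigma>" "exp (\<omega> p) * Du \<omega> p \<noteq> 0" for p
    using axial_direction_1_axial_vector[OF p(1)] p(2) axial_vector_constant[OF p(1)]
    by (intro exI[of _ "axial_vector p"]) (auto simp: axial_vector_def)
  have second: "\<exists>v2. axial_direction_2 \<Sigma> X \<omega> v2 \<and>
      (\<forall>p\<in>\<Sigma>. v2 = Dv (Du \<omega>) p *\<^sub>R Du X p - Dv (Dv \<omega>) p *\<^sub>R Dv X p + Dv \<omega> p *\<^sub>R N p)"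
    if p: "p \<in> \<Sigma>" "exp (\<omega> p) * Dv \<omega> p \<noteq> 0" for p
  proof (intro exI[of _ "- swapped.axial_vector (prod.swap p)"] conjI ballI)
    show "axial_direction_2 \<Sigma> X \<omega> (- swapped.axial_vector (prod.swap p))"
      unfolding axial_direction_2_swap
      using p by (intro axial_direction_1_minus swapped.axial_direction_1_axial_vector)
        (simp_all add: Du_swap)
    fix q assume q: "q \<in> \<Sigma>"
    have "swapped.axial_vector (prod.swap p) = swapped.axial_vector (prod.swap q)"
      using p q by (intro swapped.axial_vector_constant) simp_all
    then show "- swapped.axial_vector (prod.swap p) =
        Dv (Du \<omega>) q *\<^sub>R Du X q - Dv (Dv \<omega>) q *\<^sub>R Dv X q + Dv \<omega> q *\<^sub>R N q"
      using swapped_vector[OF q] by simp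
  qed
  have orth: "orthogonal v1 v2"
    if v: "axial_direction_1 \<Sigma> X \<omega> v1" "axial_direction_2 \<Sigma> X \<omega> v2" for v1 v2
  proof -
    obtain p where p: "p \<in> \<Sigma>" using S_nonempty by auto
    obtain c where c: "v1 = c *\<^sub>R axial_vector p"
      using axial_direction_1_parallel_axial_vector[OF v(1) p] .
    obtain d where d: "v2 = d *\<^sub>R swapped.axial_vector (prod.swap p)"
      using swapped.axial_direction_1_parallel_axial_vector[OF v(2)[unfolded axial_direction_2_swap], of "prod.swap p"] p
      by auto
    have "axial_vector p \<bullet> - swapped.axial_vector (prod.swap p)
      = Dv (Du \<omega>) p * exp (2 * \<omega> p) * (Du (Du \<omega>) p + Dv (Dv \<omega>) p) + Du \<omega> p * Dv \<omega> p"
      unfolding swapped_vector[OF p] axial_vector_def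
      by (simp only: inner_simps frame_inner p) (simp add: algebra_simps)
    also have "\<dots> = 0"
      using scale_cancel[of p] by (simp add: laplace[OF p] planarity[OF p] mult.commute)
    finally show ?thesis
      by (simp add: c d orthogonal_def)
  qed
  show ?thesis
    using first second orth by blast
qed

end
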